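(* Let $P$ and $Q$ be lattice polygons in $\mathbb{R}^2$. If $P\cap Q\neq\emptyset$ and the normal fan of $-Q$ coarsens the normal fan of $P$, then $P\cap Q$ contains a point of $\mathbb{Z}^2$.
   Context: A lattice polygon is the convex hull in $\mathbb{R}^2$ of finitely many points of $\mathbb{Z}^2$; $-Q=\{-q: q\in Q\}$. For a polygon $P$ and a face $F$ of $P$, the normal cone of $F$ is the set of linear functionals $u$ on $\mathbb{R}^2$ such that $F$ is contained in the set of points of $P$ maximizing $u$; the normal fan of $P$ is the collection of normal cones of all faces of $P$. The normal fan of $-Q$ coarsens that of $P$ means every cone of the normal fan of $P$ is contained in some cone of the normal fan of $-Q$. *)

theory Defs
  imports "HOL-Analysis.Analysis"
begin

definition int_lattice :: "(real ^ 2) set" where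
  "int_lattice = {x. \<forall>i. x $ i \<in> \<int>}"

definition lattice_polygon :: "(real ^ 2) set \<Rightarrow> bool" where
  "lattice_polygon P \<longleftrightarrow> (\<exists>S. finite S \<and> S \<subseteq> int_lattice \<and> P = convex hull S)"

definition normal_cone :: "(real ^ 2) set \<Rightarrow> (real ^ 2) set \<Rightarrow> (real ^ 2 \<Rightarrow> real) set" where
  "normal_cone P F = {u. linear u \<and> F \<subseteq> {x \<in> P. \<forall>y\<in>P. u y \<le> u x}}"

(* The library's face_of admits the empty face, whose normal cone would be the whole dual
   space and would make the coarsening relation below trivially true; it is excluded. *)
definition normal_fan :: "(real ^ 2) set \<Rightarrow> (real ^ 2 \<Rightarrow> real) set set" where
  "normal_fan P = {normal_cone P F | F. F face_of P \<and> F \<noteq> {}}"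

definition coarsens :: "'a set set \<Rightarrow> 'a set set \<Rightarrow> bool" where
  "coarsens \<G> \<F> \<longleftrightarrow> (\<forall>C\<in>\<F>. \<exists>D\<in>\<G>. C \<subseteq> D)"

end

theory Submission
  imports Defs
begin

text \<open>
  Suppose \<open>P \<inter> Q\<close> is nonempty but contains no lattice point. If each of the three sides of a lattice
  triangle meets \<open>Q\<close>, then the triangle and \<open>Q\<close> have a common lattice point: otherwise any further
  lattice point of the triangle can replace one of its vertices, and for a unimodular triangle the
  barycentric coordinates of the vertices of \<open>Q\<close> are integers, which leaves no room.

  Hence \<open>Q\<close> cuts \<open>P\<close> between two lattice points \<open>a\<close> and \<open>b\<close> of \<open>P\<close>, and every lattice point of \<open>P\<close>
  lies beyond one of the two edges of \<open>Q\<close> crossed by the segment \<open>a b\<close>. By the fan condition \<open>P\<close>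
  has an edge opposite to each of these two edges, so each opposite edge lies beyond the other
  edge of \<open>Q\<close>. The two edges of \<open>Q\<close> cut \<open>P\<close> in chords without lattice points, which are therefore
  shorter than the parallel edges of \<open>P\<close>; so the two sides of \<open>P\<close> joining its two edges would
  have to converge in both directions.
\<close>

section \<open>The planar determinant and the integer lattice\<close>

text \<open>The determinant serves as signed area and as functional: for nonzero \<open>d\<close>
  the level sets of \<open>cross2 d\<close> are the lines parallel to \<open>d\<close>. So one
  vector encodes both the direction of an edge and a functional constant on it.\<close>

definition cross2 :: "real ^ 2 \<Rightarrow> real ^ 2 \<Rightarrow> real" where
  "cross2 u v = u $ 1 * v $ 2 - u $ 2 * v $ 1"

lemma linear_cross2: "linear (cross2 u)"
  by (rule linearI) (simp_all add: cross2_def algebra_simps)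

lemma cross2_add_right: "cross2 w (u + v) = cross2 w u + cross2 w v"
  and cross2_diff_right: "cross2 w (u - v) = cross2 w u - cross2 w v"
  and cross2_scaleR_right: "cross2 w (k *\<^sub>R u) = k * cross2 w u"
  and cross2_self: "cross2 u u = 0"
  by (simp_all add: cross2_def algebra_simps)

lemma vec2_eq_iff: "x = y \<longleftrightarrow> x $ 1 = y $ 1 \<and> x $ 2 = y $ (2::2)"
  by (simp add: vec_eq_iff forall_2)

text \<open>Cramer's rule with the denominator cleared.\<close>

lemma cross2_expand: "cross2 u v *\<^sub>R z = cross2 z v *\<^sub>R u + cross2 u z *\<^sub>R v"
  by (simp add: vec2_eq_iff cross2_def algebra_simps)

lemma cross2_eq_0_imp_scaleR:
  assumes "cross2 e d = 0" "e \<noteq> 0"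
  obtains k where "d = k *\<^sub>R e"
proof (cases "e $ 1 = 0")
  case True
  then have "e $ 2 \<noteq> 0" using assms by (simp add: vec2_eq_iff)
  then have "d = (d $ 2 / e $ 2) *\<^sub>R e"
    using assms True by (simp add: vec2_eq_iff cross2_def)
  then show ?thesis using that by blast
next
  case False
  then have "d = (d $ 1 / e $ 1) *\<^sub>R e"
    using assms by (simp add: vec2_eq_iff cross2_def field_simps)
  then show ?thesis using that by blast
qed

lemma int_lattice_add: "x \<in> int_lattice \<Longrightarrow> y \<in> int_lattice \<Longrightarrow> x + y \<in> int_lattice"
  and int_lattice_diff: "x \<in> int_lattice \<Longrightarrow> y \<in> int_lattice \<Longrightarrow> x - y \<in> int_lattice"
  and int_lattice_scaleR: "k \<in> \<int> \<Longrightarrow> x \<in> int_lattice \<Longrightarrow> k *\<^sub>R x \<in> int_lattice"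
  by (simp_all add: int_lattice_def)

lemma cross2_int_lattice: "x \<in> int_lattice \<Longrightarrow> y \<in> int_lattice \<Longrightarrow> cross2 x y \<in> \<int>"
  by (simp add: int_lattice_def cross2_def)

section \<open>Bounds on convex hulls and positions on a line\<close>

lemma linear_le_convex_hull:
  fixes q :: "'a::real_vector \<Rightarrow> real"
  assumes "linear q" "\<And>v. v \<in> V \<Longrightarrow> q v \<le> \<beta>" "z \<in> convex hull V"
  shows "q z \<le> \<beta>"
proof -
  have "convex {z. q z \<le> \<beta>}"
    using convex_linear_vimage[OF assms(1), of "{..\<beta>}"] by (simp add: vimage_def)
  then have "convex hull V \<subseteq> {z. q z \<le> \<beta>}"
    using assms(2) by (intro hull_minimal) auto
  then show ?thesis using assms(3) by blast
qed

lemma linear_less_convex_hull: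
  fixes q :: "'a::real_vector \<Rightarrow> real"
  assumes "linear q" "\<And>v. v \<in> V \<Longrightarrow> q v < \<beta>" "z \<in> convex hull V"
  shows "q z < \<beta>"
proof -
  have "convex {z. q z < \<beta>}"
    using convex_linear_vimage[OF assms(1), of "{..<\<beta>}"] by (simp add: vimage_def)
  then have "convex hull V \<subseteq> {z. q z < \<beta>}"
    using assms(2) by (intro hull_minimal) auto
  then show ?thesis using assms(3) by blast
qed

lemma linear_ge_convex_hull:
  fixes q :: "'a::real_vector \<Rightarrow> real"
  assumes "linear q" "\<And>v. v \<in> V \<Longrightarrow> \<beta> \<le> q v" "z \<in> convex hull V"
  shows "\<beta> \<le> q z"
  using linear_le_convex_hull[OF linear_compose_neg[OF assms(1)], of V "-\<beta>" z] assms by simp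

lemma linear_greater_convex_hull:
  fixes q :: "'a::real_vector \<Rightarrow> real"
  assumes "linear q" "\<And>v. v \<in> V \<Longrightarrow> \<beta> < q v" "z \<in> convex hull V"
  shows "\<beta> < q z"
  using linear_less_convex_hull[OF linear_compose_neg[OF assms(1)], of V "-\<beta>" z] assms by simp

text \<open>An intermediate value for an affine function on the unit interval. It supplies the point
  at which a segment crosses a level line of a functional.\<close>

lemma crossing_coefficient:
  fixes s t \<kappa> :: real
  assumes "s \<le> \<kappa>" "\<kappa> \<le> t"
  obtains l where "0 \<le> l" "l \<le> 1" "(1 - l) * s + l * t = \<kappa>"
proof (cases "s = t")
  case True
  with assms that[of 0] show ?thesis by simp
next
  case False
  then have "(\<kappa> - s) / (t - s) * (t - s) = \<kappa> - s" by simp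
  then have "(1 - (\<kappa> - s) / (t - s)) * s + (\<kappa> - s) / (t - s) * t = \<kappa>"
    by (simp only: left_diff_distrib right_diff_distrib mult_1)
  then show ?thesis
    using assms False by (intro that[of "(\<kappa> - s) / (t - s)"]) (auto simp: divide_simps)
qed

text \<open>By convexity \<open>C\<close> contains everything between its point \<open>z\<close> on
  the segment and its point with parameter \<open>k\<close>. If \<open>k\<close> were at most 0 or
  at least 1, this stretch would contain \<open>a\<close> or \<open>b\<close>.\<close>

lemma convex_line_in_open_segment:
  fixes a b :: "'a::real_vector"
  assumes C: "convex C" "a \<notin> C" "b \<notin> C" and z: "z \<in> C" "z \<in> closed_segment a b"
    and z': "a + k *\<^sub>R (b - a) \<in> C"
  shows "0 < k \<and> k < 1"
proof -
  obtain l where l: "0 \<le> l" "l \<le> 1" "z = (1 - l) *\<^sub>R a + l *\<^sub>R b"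
    using z(2) by (auto simp: in_segment)
  have seg: "a + ((1 - \<mu>) * k + \<mu> * l) *\<^sub>R (b - a) \<in> C" if "0 \<le> \<mu>" "\<mu> \<le> 1" for \<mu>
  proof -
    have "(1 - \<mu>) *\<^sub>R (a + k *\<^sub>R (b - a)) + \<mu> *\<^sub>R z \<in> C"
      using convexD[OF C(1) z' z(1), of "1 - \<mu>" \<mu>] that by simp
    also have "(1 - \<mu>) *\<^sub>R (a + k *\<^sub>R (b - a)) + \<mu> *\<^sub>R z = a + ((1 - \<mu>) * k + \<mu> * l) *\<^sub>R (b - a)"
      unfolding l(3) by (simp add: algebra_simps)
    finally show ?thesis .
  qed
  have "\<not> k \<le> 0"
  proof
    assume "k \<le> 0"
    then obtain \<mu> where "0 \<le> \<mu>" "\<mu> \<le> 1" "(1 - \<mu>) * k + \<mu> * l = 0"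
      using crossing_coefficient[of k 0 l] l(1) by blast
    then show False using seg[of \<mu>] C(2) by simp
  qed
  moreover have "\<not> 1 \<le> k"
  proof
    assume "1 \<le> k"
    then obtain \<mu> where "0 \<le> \<mu>" "\<mu> \<le> 1" "(1 - \<mu>) * l + \<mu> * k = 1"
      using crossing_coefficient[of l 1 k] l(2) by blast
    then show False using seg[of "1 - \<mu>"] C(3) by (simp add: algebra_simps)
  qed
  ultimately show ?thesis by simp
qed

section \<open>Lattice triangles all of whose sides meet a lattice polygon\<close>

text \<open>If all lattice points had integer coordinates in the basis \<open>b - a\<close>,
  \<open>c - a\<close>, the inverse of the basis matrix would be integral with determinant
  \<open>1 / D\<close>, impossible for \<open>D\<close> of absolute value above 1. The fractional
  parts of a noninteger coordinate pair give a lattice point of the parallelogram, and a reflection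
  brings it into the triangle.\<close>

lemma lattice_triangle_has_nonvertex:
  assumes lat: "a \<in> int_lattice" "b \<in> int_lattice" "c \<in> int_lattice"
    and D: "1 < \<bar>cross2 (b - a) (c - a)\<bar>"
  obtains \<alpha> \<beta> \<gamma> where "0 \<le> \<alpha>" "0 \<le> \<beta>" "0 \<le> \<gamma>" "\<alpha> < 1" "\<beta> < 1" "\<gamma> < 1" "\<alpha> + \<beta> + \<gamma> = 1"
    "\<alpha> *\<^sub>R a + \<beta> *\<^sub>R b + \<gamma> *\<^sub>R c \<in> int_lattice"
proof -
  define u v where "u = b - a" and "v = c - a"
  define D where "D = cross2 u v"
  have uv: "u \<in> int_lattice" "v \<in> int_lattice" using lat by (auto simp: u_def v_def int_lattice_diff)
  have D1: "1 < \<bar>D\<bar>" "D \<noteq> 0" using D by (auto simp: D_def u_def v_def)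
  have "\<exists>z\<in>int_lattice. cross2 z v / D \<notin> \<int> \<or> cross2 u z / D \<notin> \<int>"
  proof (rule ccontr)
    assume "\<not> ?thesis"
    then have *: "cross2 z v / D \<in> \<int>" "cross2 u z / D \<in> \<int>" if "z \<in> int_lattice" for z
      using that by blast+
    \<comment> \<open>The coordinates of the unit vectors are the entries of the inverse matrix; the
      combination formed below is its determinant.\<close>
    have e: "axis 1 1 \<in> int_lattice" "axis 2 1 \<in> int_lattice"
      by (auto simp: int_lattice_def axis_def)
    have "v $ 2 / D \<in> \<int>" "- (u $ 2) / D \<in> \<int>" "- (v $ 1) / D \<in> \<int>" "u $ 1 / D \<in> \<int>"
      using *[OF e(1)] *[OF e(2)] by (simp_all add: cross2_def axis_def)
    then have "(u $ 1 / D) * (v $ 2 / D) - (- (u $ 2) / D) * (- (v $ 1) / D) \<in> \<int>"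
      by (intro Ints_diff Ints_mult)
    also have "(u $ 1 / D) * (v $ 2 / D) - (- (u $ 2) / D) * (- (v $ 1) / D) = D / (D * D)"
      by (subst (5) D_def) (simp add: cross2_def diff_divide_distrib)
    also have "\<dots> = 1 / D" using D1 by simp
    finally have "1 / D \<in> \<int>" .
    moreover have "\<bar>1 / D\<bar> < 1" "1 / D \<noteq> 0" using D1 by auto
    ultimately show False using Ints_nonzero_abs_less1 by blast
  qed
  then obtain z where z: "z \<in> int_lattice" "cross2 z v / D \<notin> \<int> \<or> cross2 u z / D \<notin> \<int>" by blast
  define s t where "s = frac (cross2 z v / D)" and "t = frac (cross2 u z / D)"
  have st: "0 \<le> s" "s < 1" "0 \<le> t" "t < 1" by (auto simp: s_def t_def frac_lt_1)
  have st0: "s \<noteq> 0 \<or> t \<noteq> 0" using z(2) by (auto simp: s_def t_def)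
  have "z = (cross2 z v / D) *\<^sub>R u + (cross2 u z / D) *\<^sub>R v"
  proof -
    have "D *\<^sub>R z = D *\<^sub>R ((cross2 z v / D) *\<^sub>R u + (cross2 u z / D) *\<^sub>R v)"
      using cross2_expand[of u v z] D1 by (simp add: D_def scaleR_right_distrib)
    then show ?thesis using D1 by simp
  qed
  then have "s *\<^sub>R u + t *\<^sub>R v = z - of_int \<lfloor>cross2 z v / D\<rfloor> *\<^sub>R u - of_int \<lfloor>cross2 u z / D\<rfloor> *\<^sub>R v"
    by (simp add: s_def t_def frac_def algebra_simps)
  also have "\<dots> \<in> int_lattice"
    using z uv by (intro int_lattice_diff int_lattice_scaleR) auto
  finally have st_lat: "s *\<^sub>R u + t *\<^sub>R v \<in> int_lattice" .
  show ?thesis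
  proof (cases "s + t \<le> 1")
    case True
    have "(1 - s - t) *\<^sub>R a + s *\<^sub>R b + t *\<^sub>R c = a + (s *\<^sub>R u + t *\<^sub>R v)"
      by (simp add: u_def v_def algebra_simps)
    also have "\<dots> \<in> int_lattice" using st_lat lat by (simp add: int_lattice_add)
    finally show ?thesis using True st st0 by (intro that[of "1 - s - t" s t]) auto
  next
    case False
    \<comment> \<open>The point lies in the far half of the parallelogram, so it is reflected in the
      centre, the midpoint of \<open>b c\<close>.\<close>
    have "(s + t - 1) *\<^sub>R a + (1 - s) *\<^sub>R b + (1 - t) *\<^sub>R c = b + c - a - (s *\<^sub>R u + t *\<^sub>R v)"
      by (simp add: u_def v_def algebra_simps)
    also have "\<dots> \<in> int_lattice" using st_lat lat by (simp add: int_lattice_add int_lattice_diff)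
    finally show ?thesis using False st by (intro that[of "s + t - 1" "1 - s" "1 - t"]) auto
  qed
qed

text \<open>Adding to \<open>w\<close> the multiple \<open>r\<close> of \<open>b\<close> that turns
  its \<open>a\<close>-part into a multiple of \<open>z\<^sub>c\<close> leaves only
  \<open>z\<^sub>b\<close> and \<open>z\<^sub>c\<close> on the other side. Division by
  \<open>1 + r\<close> then displays a common point of the two segments.\<close>

lemma segment_meets_beyond_corner:
  fixes a b z\<^sub>b z\<^sub>c :: "'a::real_vector"
  assumes w: "w \<in> convex hull {a, z\<^sub>b, z\<^sub>c}" and z: "z\<^sub>c \<in> closed_segment a b" "z\<^sub>c \<noteq> b"
  shows "closed_segment w b \<inter> closed_segment z\<^sub>b z\<^sub>c \<noteq> {}"
proof -
  obtain l m n where lmn: "0 \<le> l" "0 \<le> m" "0 \<le> n" "l + m + n = 1" "w = l *\<^sub>R a + m *\<^sub>R z\<^sub>b + n *\<^sub>R z\<^sub>c"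
    using w by (auto simp: convex_hull_3)
  obtain p where p: "0 \<le> p" "p \<le> 1" "z\<^sub>c = (1 - p) *\<^sub>R a + p *\<^sub>R b"
    using z(1) by (auto simp: in_segment)
  have "p \<noteq> 1" using p z(2) by auto
  then have p1: "0 < 1 - p" using p by simp
  define r where "r = l * p / (1 - p)"
  have r: "0 \<le> r" using lmn p p1 by (simp add: r_def)
  have rl: "r + l = l / (1 - p)" using p1 by (simp add: r_def field_simps)
  have "(r + l) *\<^sub>R z\<^sub>c = l *\<^sub>R a + r *\<^sub>R b"
    unfolding rl unfolding p(3) using p1 by (simp add: scaleR_right_distrib r_def)
  then have eq: "w + r *\<^sub>R b = m *\<^sub>R z\<^sub>b + (n + r + l) *\<^sub>R z\<^sub>c"
    using lmn(5) by (simp add: algebra_simps)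
  define k where "k = inverse (1 + r)"
  have k: "k * (1 + r) = 1" "0 < k" using r by (auto simp: k_def)
  have "k *\<^sub>R w + (k * r) *\<^sub>R b = (k * m) *\<^sub>R z\<^sub>b + (k * (n + r + l)) *\<^sub>R z\<^sub>c"
    using arg_cong[OF eq, of "scaleR k"] by (simp add: scaleR_right_distrib)
  moreover have "k *\<^sub>R w + (k * r) *\<^sub>R b \<in> closed_segment w b"
  proof -
    have "k = 1 - k * r" using k(1) by (simp add: algebra_simps)
    then have "k *\<^sub>R w + (k * r) *\<^sub>R b = (1 - k * r) *\<^sub>R w + (k * r) *\<^sub>R b" by simp
    moreover have "0 \<le> k * r" "k * r \<le> 1" using k r \<open>k = 1 - k * r\<close> by auto
    ultimately show ?thesis unfolding in_segment by blast
  qed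
  moreover have "k * m = 1 - k * (n + r + l)"
  proof -
    have "m + (n + r + l) = 1 + r" using lmn(4) by simp
    then have "k * (m + (n + r + l)) = 1" using k(1) by metis
    then show ?thesis by (simp add: algebra_simps)
  qed
  then have "(k * m) *\<^sub>R z\<^sub>b + (k * (n + r + l)) *\<^sub>R z\<^sub>c \<in> closed_segment z\<^sub>b z\<^sub>c"
  proof -
    have "0 \<le> k * m" "0 \<le> k * (n + r + l)" using k r lmn by auto
    then show ?thesis
      unfolding in_segment using \<open>k * m = 1 - k * (n + r + l)\<close>
      by (intro exI[of _ "k * (n + r + l)"]) auto
  qed
  ultimately show ?thesis by auto
qed

text \<open>The functional \<open>u\<close>, which separates \<open>w\<close> and \<open>a\<close> from \<open>Q\<close>, forces \<open>w\<close> into the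
  corner of the triangle at \<open>a\<close> that is cut off by \<open>z\<^sub>b z\<^sub>c\<close>.\<close>

lemma corner_replacement:
  fixes a b c :: "'a::real_vector" and u :: "'a \<Rightarrow> real"
  assumes Q: "convex Q" and z: "z\<^sub>c \<in> Q" "z\<^sub>c \<in> closed_segment a b" "z\<^sub>b \<in> Q" "z\<^sub>b \<in> closed_segment c a"
    and u: "linear u" "\<And>z. z \<in> Q \<Longrightarrow> u z < u w" "u w \<le> u a" 
    and w: "0 \<le> \<alpha>" "0 \<le> \<beta>" "0 \<le> \<gamma>" "\<alpha> + \<beta> + \<gamma> = 1" "w = \<alpha> *\<^sub>R a + \<beta> *\<^sub>R b + \<gamma> *\<^sub>R c"
    and bc: "b \<notin> Q" "c \<notin> Q"
  shows "closed_segment w b \<inter> Q \<noteq> {}" "closed_segment c w \<inter> Q \<noteq> {}"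
proof -
  obtain p where p: "0 \<le> p" "p \<le> 1" "z\<^sub>c = (1 - p) *\<^sub>R a + p *\<^sub>R b"
    using z(2) by (auto simp: in_segment)
  obtain r where r: "0 \<le> r" "r \<le> 1" "z\<^sub>b = (1 - r) *\<^sub>R a + r *\<^sub>R c"
    using z(4) by (auto simp: in_segment closed_segment_commute[of c a])
  have a: "a \<notin> Q" using u(2)[of a] u(3) by (metis not_le)
  have "p \<noteq> 0" "r \<noteq> 0" using p(3) r(3) z a by auto
  then have pr: "0 < p" "0 < r" using p r by auto
  \<comment> \<open>Expressing \<open>b\<close> and \<open>c\<close> through \<open>a\<close> and
    the crossing points gives the coordinates of \<open>w\<close> in \<open>a\<close>,
    \<open>z\<^sub>b\<close>, \<open>z\<^sub>c\<close>; this is the coefficient of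
    \<open>a\<close>.\<close>
  define \<delta> where "\<delta> = 1 - \<beta> / p - \<gamma> / r"
  have b': "\<beta> *\<^sub>R b = (\<beta> / p) *\<^sub>R z\<^sub>c + (\<beta> - \<beta> / p) *\<^sub>R a"
    using pr unfolding p(3) by (simp add: algebra_simps)
  have c': "\<gamma> *\<^sub>R c = (\<gamma> / r) *\<^sub>R z\<^sub>b + (\<gamma> - \<gamma> / r) *\<^sub>R a"
    using pr unfolding r(3) by (simp add: algebra_simps)
  have \<alpha>: "\<alpha> = 1 - \<beta> - \<gamma>" using w(4) by simp
  have weq: "w = \<delta> *\<^sub>R a + (\<gamma> / r) *\<^sub>R z\<^sub>b + (\<beta> / p) *\<^sub>R z\<^sub>c"
    unfolding w(5) b' c' \<delta>_def \<alpha> by (simp add: algebra_simps)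
  have nn: "0 \<le> \<gamma> / r" "0 \<le> \<beta> / p" using w pr by auto
  have uw: "u w = \<delta> * u a + (\<gamma> / r) * u z\<^sub>b + (\<beta> / p) * u z\<^sub>c"
    by (subst weq) (simp add: linear_add[OF u(1)] linear_cmul[OF u(1)])
  \<comment> \<open>\<open>u\<close> is at least \<open>u w\<close> at \<open>a\<close> and below
    \<open>u w\<close> at the crossing points. A negative weight on \<open>a\<close> would push the
    combination, whose weights sum to 1, strictly below \<open>u w\<close>.\<close>
  have "0 \<le> \<delta>"
  proof (rule ccontr)
    assume neg: "\<not> 0 \<le> \<delta>"
    have "\<delta> * u a \<le> \<delta> * u w" using neg u(3) by (simp add: mult_left_mono_neg)
    moreover have "(\<gamma> / r) * u z\<^sub>b \<le> (\<gamma> / r) * u w" "(\<beta> / p) * u z\<^sub>c \<le> (\<beta> / p) * u w"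
      using nn u(2)[OF z(1)] u(2)[OF z(3)] by (auto intro!: mult_left_mono simp del: times_divide_eq_left)
    moreover have "(\<gamma> / r) * u z\<^sub>b < (\<gamma> / r) * u w \<or> (\<beta> / p) * u z\<^sub>c < (\<beta> / p) * u w"
    proof (cases "\<gamma> = 0")
      case True
      then have "0 < \<beta> / p" using neg nn by (auto simp: \<delta>_def)
      then show ?thesis using u(2)[OF z(1)] mult_strict_left_mono by blast
    next
      case False
      then have "0 < \<gamma> / r" using w pr by simp
      then show ?thesis using u(2)[OF z(3)] mult_strict_left_mono by blast
    qed
    ultimately have "u w < \<delta> * u w + (\<gamma> / r) * u w + (\<beta> / p) * u w" using uw by linarith
    also have "\<dots> = u w" by (simp add: \<delta>_def algebra_simps)
    finally show False by simp
  qed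
  then have w_hull: "w \<in> convex hull {a, z\<^sub>b, z\<^sub>c}"
    unfolding convex_hull_3 using weq nn \<delta>_def
    by (intro CollectI exI[of _ \<delta>] exI[of _ "\<gamma> / r"] exI[of _ "\<beta> / p"]) auto
  have sub: "closed_segment z\<^sub>b z\<^sub>c \<subseteq> Q" using Q z by (simp add: closed_segment_subset)
  have "closed_segment w b \<inter> closed_segment z\<^sub>b z\<^sub>c \<noteq> {}"
    using segment_meets_beyond_corner[OF w_hull z(2)] z(1) bc by metis
  then show "closed_segment w b \<inter> Q \<noteq> {}" using sub by blast
  have "closed_segment w c \<inter> closed_segment z\<^sub>c z\<^sub>b \<noteq> {}"
    using segment_meets_beyond_corner[of w a z\<^sub>c z\<^sub>b c] w_hull z(3,4) bc
    by (metis closed_segment_commute insert_commute)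
  then show "closed_segment c w \<inter> Q \<noteq> {}" using sub by (metis closed_segment_commute disjoint_iff subsetD)
qed

text \<open>A line or hyperplane separating \<open>b\<close> strictly from \<open>Q\<close> would
  have both \<open>a\<close> and \<open>c\<close> on the side of \<open>Q\<close>, since the
  segments from \<open>b\<close> to them reach \<open>Q\<close>. Then \<open>b\<close>, lying
  between them, would be on that side too.\<close>

lemma collinear_triple_meets:
  fixes a b c :: "'a::euclidean_space"
  assumes Q: "convex Q" "closed Q" and b: "b \<in> closed_segment a c"
    and m: "closed_segment a b \<inter> Q \<noteq> {}" "closed_segment b c \<inter> Q \<noteq> {}"
  shows "b \<in> Q"
proof (rule ccontr)
  assume "b \<notin> Q"
  then obtain n \<beta> where n: "n \<bullet> b < \<beta>" "\<And>z. z \<in> Q \<Longrightarrow> \<beta> < n \<bullet> z"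
    using separating_hyperplane_closed_point[OF Q, of b] by blast
  have lin: "linear ((\<bullet>) n)" by (simp add: linear_iff inner_right_distrib)
  have "\<beta> < n \<bullet> x" if "closed_segment b x \<inter> Q \<noteq> {}" for x
  proof (rule ccontr)
    assume "\<not> ?thesis"
    then have "n \<bullet> y \<le> \<beta>" if "y \<in> closed_segment b x" for y
      using n(1) that by - (rule linear_le_convex_hull[OF lin, of "{b, x}"]; (auto simp: segment_convex_hull))
    then show False using that n(2) by fastforce
  qed
  then have "\<beta> < n \<bullet> a" "\<beta> < n \<bullet> c" using m by (auto simp: closed_segment_commute)
  then have "\<beta> < n \<bullet> b"
    using b by - (rule linear_greater_convex_hull[OF lin, of "{a, c}"]; (auto simp: segment_convex_hull))
  with n show False by simp
qed

lemma cross2_eq_0_imp_between: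
  assumes "cross2 (b - a) (c - a) = 0"
  shows "a \<in> closed_segment b c \<or> b \<in> closed_segment c a \<or> c \<in> closed_segment a b"
proof -
  have "collinear {a, b, c}"
  proof (cases "b = a")
    case True
    then show ?thesis by simp
  next
    case False
    then obtain k where "c - a = k *\<^sub>R (b - a)" using cross2_eq_0_imp_scaleR[OF assms] by auto
    then have "collinear {b - a, 0, c - a}" 
      by (metis collinear_lemma insert_commute)
    then show ?thesis using collinear_3[of b a c] by (simp add: insert_commute)
  qed
  then show ?thesis by (simp add: collinear_between_cases between_mem_segment)
qed

text \<open>In the affine coordinates \<open>s\<close>, \<open>t\<close> the triangle has vertices
  (0,0), (1,0), (0,1), and the vertices of \<open>Q\<close> are integral because \<open>D\<close> is
  its own inverse. If \<open>Q\<close> misses the three vertices, it meets each side line only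
  strictly inside the side. This forces vertices \<open>x\<close>, \<open>y\<close> of
  \<open>Q\<close> on either side of the line \<open>s = 0\<close>, or with \<open>y\<close> on it,
  both with \<open>t\<close> at least 1, so the segment \<open>x y\<close> meets that line outside
  the side.\<close>

lemma unimodular_triangle_vertex_in_polygon:
  assumes V: "V \<subseteq> int_lattice" "Q = convex hull V"
    and lat: "a \<in> int_lattice" "b \<in> int_lattice" "c \<in> int_lattice"
    and D: "\<bar>cross2 (b - a) (c - a)\<bar> = 1"
    and m: "closed_segment a b \<inter> Q \<noteq> {}" "closed_segment b c \<inter> Q \<noteq> {}" "closed_segment c a \<inter> Q \<noteq> {}"
  shows "a \<in> Q \<or> b \<in> Q \<or> c \<in> Q"
proof (rule ccontr)
  assume "\<not> ?thesis"
  then have no: "a \<notin> Q" "b \<notin> Q" "c \<notin> Q" by auto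
  have Q: "convex Q" by (simp add: V)
  define D where "D = cross2 (b - a) (c - a)"
  have DD: "D * D = 1" using D unfolding D_def by (metis abs_mult_self_eq mult_1)
  have D0: "D \<noteq> 0" using DD by auto
  have DZ: "D \<in> \<int>" unfolding D_def using lat by (intro cross2_int_lattice int_lattice_diff)
  define s t where "s = (\<lambda>z. D * cross2 (z - a) (c - a))" and "t = (\<lambda>z. D * cross2 (b - a) (z - a))"
  have st: "z = a + s z *\<^sub>R (b - a) + t z *\<^sub>R (c - a)" for z
  proof -
    have "z - a = (D * D) *\<^sub>R (z - a)" by (simp add: DD)
    also have "\<dots> = D *\<^sub>R (cross2 (z - a) (c - a) *\<^sub>R (b - a) + cross2 (b - a) (z - a) *\<^sub>R (c - a))"
      by (metis D_def cross2_expand scaleR_scaleR)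
    finally show ?thesis by (simp add: s_def t_def algebra_simps)
  qed
  have sZ: "s z \<in> \<int>" "t z \<in> \<int>" if "z \<in> V" for z
    using that V lat DZ unfolding s_def t_def
    by (auto intro!: Ints_mult cross2_int_lattice int_lattice_diff)
  have s_comb: "s ((1 - l) *\<^sub>R x + l *\<^sub>R y) = (1 - l) * s x + l * s y"
    and t_comb: "t ((1 - l) *\<^sub>R x + l *\<^sub>R y) = (1 - l) * t x + l * t y" for l x y
    by (simp_all add: s_def t_def cross2_def algebra_simps)
  have ab: "0 < s z \<and> s z < 1" if "z \<in> Q" "t z = 0" for z
    using convex_line_in_open_segment[OF Q no(1,2), of _ "s z"] m(1) st[of z] that by auto
  have ca: "0 < t z \<and> t z < 1" if "z \<in> Q" "s z = 0" for z
    using convex_line_in_open_segment[OF Q no(1,3), of _ "t z"] m(3) st[of z] that 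
    by (auto simp: closed_segment_commute)
  have bc: "0 < t z \<and> t z < 1" if "z \<in> Q" "s z + t z = 1" for z
  proof -
    have "s z = 1 - t z" using that by simp
    then have "z = a + (1 - t z) *\<^sub>R (b - a) + t z *\<^sub>R (c - a)" using st[of z] by metis
    also have "\<dots> = b + t z *\<^sub>R (c - b)" by (simp add: algebra_simps)
    finally have "b + t z *\<^sub>R (c - b) \<in> Q" using that(1) by metis
    then show ?thesis
      using convex_line_in_open_segment[OF Q no(2,3), of _ "t z"] m(2) by blast
  qed
  have sv: "s a = 0" "s b = 1" "s c = 0" "t a = 0" "t b = 0" "t c = 1"
    using DD by (auto simp: s_def t_def D_def cross2_def)
  obtain z\<^sub>c where zc: "z\<^sub>c \<in> Q" "t z\<^sub>c = 0" "0 < s z\<^sub>c"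
  proof -
    obtain z where "z \<in> Q" "z \<in> closed_segment a b" using m(1) by blast
    moreover from this obtain l where "z = (1 - l) *\<^sub>R a + l *\<^sub>R b" by (auto simp: in_segment)
    moreover from this have "t z = 0" by (simp add: t_comb sv)
    ultimately show ?thesis using that ab by blast
  qed
  obtain z\<^sub>b where zb: "z\<^sub>b \<in> Q" "s z\<^sub>b = 0" "0 < t z\<^sub>b" "t z\<^sub>b < 1"
  proof -
    obtain z where "z \<in> Q" "z \<in> closed_segment c a" using m(3) by blast
    moreover from this obtain l where "z = (1 - l) *\<^sub>R c + l *\<^sub>R a" by (auto simp: in_segment)
    moreover from this have "s z = 0" by (simp add: s_comb sv)
    ultimately show ?thesis using that ca by blast
  qed
  obtain z\<^sub>a where za: "z\<^sub>a \<in> Q" "s z\<^sub>a + t z\<^sub>a = 1"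
  proof -
    obtain z where "z \<in> Q" "z \<in> closed_segment b c" using m(2) by blast
    moreover from this obtain l where "z = (1 - l) *\<^sub>R b + l *\<^sub>R c" by (auto simp: in_segment)
    moreover from this have "s z + t z = 1" by (simp add: s_comb t_comb sv)
    ultimately show ?thesis using that by blast
  qed
  have VQ: "v \<in> Q" if "v \<in> V" for v using that by (simp add: V hull_inc)
  have cross: "\<exists>l. 0 \<le> l \<and> l \<le> 1 \<and> (1 - l) *\<^sub>R x + l *\<^sub>R y \<in> Q \<and> (1 - l) * f + l * g = k"
    if "x \<in> Q" "y \<in> Q" "f \<le> k" "k \<le> g" for x y and f g k :: real
    using crossing_coefficient[OF that(3,4)] convexD[OF Q that(1,2)]
    by (metis add.commute diff_add_cancel diff_ge_0_iff_ge)
  have s_eq: "s z = D * cross2 (c - a) a - D * cross2 (c - a) z" for z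
    by (simp add: s_def cross2_def algebra_simps)
  have st_eq: "s z + t z = D * cross2 (b - c) z - D * cross2 (b - c) a" for z
    by (simp add: s_def t_def cross2_def algebra_simps)
  have lin: "linear (\<lambda>z. D * cross2 w z)" for w
    by (rule linearI) (simp_all add: cross2_def algebra_simps)
  have tV: "\<not> (0 < t v \<and> t v < 1)" if "v \<in> V" for v
    using sZ(2)[OF that] by (auto elim!: Ints_cases)
  \<comment> \<open>A vertex with \<open>s = 0\<close> would have \<open>t\<close> strictly between
    0 and 1, against integrality. Were all vertices on the positive side, \<open>Q\<close> could not
    contain \<open>z\<^sub>b\<close>.\<close>
  obtain x where x: "x \<in> V" "s x < 0"
  proof -
    have "\<exists>x\<in>V. s x < 0"
    proof (rule ccontr)
      assume neg: "\<not> ?thesis"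
      have "D * cross2 (c - a) v < D * cross2 (c - a) a" if "v \<in> V" for v
      proof -
        have "s v \<noteq> 0" using ca[OF VQ[OF that]] tV[OF that] by blast
        moreover have "0 \<le> s v" using neg that by (meson not_less)
        ultimately show ?thesis using s_eq[of v] by linarith
      qed
      then have "D * cross2 (c - a) z\<^sub>b < D * cross2 (c - a) a"
        using zb(1) V by - (rule linear_less_convex_hull[OF lin, of V]; auto)
      then show False using zb(2) s_eq[of z\<^sub>b] by linarith
    qed
    then show ?thesis using that by blast
  qed
  obtain y where y: "y \<in> V" "1 < s y + t y"
  proof -
    have "\<exists>x\<in>V. 1 < s x + t x"
    proof (rule ccontr)
      assume neg: "\<not> ?thesis"
      have "D * cross2 (b - c) v < 1 + D * cross2 (b - c) a" if "v \<in> V" for v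
      proof -
        have "s v + t v \<noteq> 1" using bc[OF VQ[OF that]] tV[OF that] by blast
        moreover have "s v + t v \<le> 1" using neg that by (meson not_less)
        ultimately show ?thesis using st_eq[of v] by linarith
      qed
      then have "D * cross2 (b - c) z\<^sub>a < 1 + D * cross2 (b - c) a"
        using za(1) V by - (rule linear_less_convex_hull[OF lin, of V]; auto)
      then show False using za(2) st_eq[of z\<^sub>a] by linarith
    qed
    then show ?thesis using that by blast
  qed
  \<comment> \<open>Otherwise the segment from \<open>x\<close> to \<open>z\<^sub>c\<close> meets
    \<open>s = 0\<close> with \<open>t\<close> at most 0. The next two claims use segments from
    \<open>z\<^sub>c\<close> and \<open>z\<^sub>b\<close> to \<open>y\<close> and the line
    \<open>s + t = 1\<close> in the same way.\<close>
  have tx: "1 \<le> t x"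
  proof (rule ccontr)
    assume "\<not> 1 \<le> t x"
    then have "t x \<le> 0" using sZ(2)[OF x(1)] by (auto elim!: Ints_cases)
    obtain l where l: "0 \<le> l" "l \<le> 1" "(1 - l) *\<^sub>R x + l *\<^sub>R z\<^sub>c \<in> Q" "(1 - l) * s x + l * s z\<^sub>c = 0"
      using cross[OF VQ[OF x(1)] zc(1), of "s x" 0 "s z\<^sub>c"] x zc by auto
    have "(1 - l) * t x \<le> 0" using l \<open>t x \<le> 0\<close> by (simp add: mult_nonneg_nonpos)
    then show False using ca[OF l(3)] l(4) zc(2) by (simp add: s_comb t_comb)
  qed
  have ty: "1 \<le> t y"
  proof (rule ccontr)
    assume "\<not> 1 \<le> t y"
    then have "t y \<le> 0" using sZ(2)[OF y(1)] by (auto elim!: Ints_cases)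
    have "s z\<^sub>c + t z\<^sub>c \<le> 1" using ab zc by fastforce
    then obtain l where l: "0 \<le> l" "l \<le> 1" "(1 - l) *\<^sub>R z\<^sub>c + l *\<^sub>R y \<in> Q"
        "(1 - l) * (s z\<^sub>c + t z\<^sub>c) + l * (s y + t y) = 1"
      using cross[OF zc(1) VQ[OF y(1)], of "s z\<^sub>c + t z\<^sub>c" 1 "s y + t y"] y by auto
    have "l * t y \<le> 0" using l \<open>t y \<le> 0\<close> by (simp add: mult_nonneg_nonpos)
    moreover have "(1 - l) * s z\<^sub>c + l * s y + ((1 - l) * t z\<^sub>c + l * t y) = 1"
      using l(4) by (simp add: algebra_simps)
    ultimately show False using bc[OF l(3), unfolded s_comb t_comb] zc(2) by auto
  qed
  have sy: "0 \<le> s y"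
  proof (rule ccontr)
    assume "\<not> 0 \<le> s y"
    obtain l where l: "0 \<le> l" "l \<le> 1" "(1 - l) *\<^sub>R z\<^sub>b + l *\<^sub>R y \<in> Q"
        "(1 - l) * (s z\<^sub>b + t z\<^sub>b) + l * (s y + t y) = 1"
      using cross[OF zb(1) VQ[OF y(1)], of "s z\<^sub>b + t z\<^sub>b" 1 "s y + t y"] y zb by auto
    have "l * s y \<le> 0" using l \<open>\<not> 0 \<le> s y\<close> by (simp add: mult_nonneg_nonpos)
    moreover have "(1 - l) * s z\<^sub>b + l * s y + ((1 - l) * t z\<^sub>b + l * t y) = 1"
      using l(4) by (simp add: algebra_simps)
    ultimately show False using bc[OF l(3), unfolded s_comb t_comb] zb(2) by auto
  qed
  obtain l where l: "0 \<le> l" "l \<le> 1" "(1 - l) *\<^sub>R x + l *\<^sub>R y \<in> Q" "(1 - l) * s x + l * s y = 0"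
    using cross[OF VQ[OF x(1)] VQ[OF y(1)], of "s x" 0 "s y"] x sy by auto
  have "(1 - l) * 1 + l * 1 \<le> (1 - l) * t x + l * t y"
    using l tx ty by (intro add_mono mult_left_mono) auto
  then show False using ca[OF l(3)] l(4) by (simp add: s_comb t_comb)
qed

text \<open>Induction on the absolute determinant, an integer, so that \<open>nat\<close> and floor
  only change its type. If no vertex is in \<open>Q\<close>, there is a further lattice point
  \<open>w\<close> of the triangle. If \<open>w\<close> is not in \<open>Q\<close> either, a
  functional separates it from \<open>Q\<close>, and a vertex at least as far out is replaced by
  \<open>w\<close>. This multiplies the determinant by a barycentric coordinate of \<open>w\<close>,
  which is below 1.\<close>

lemma lattice_triangle_sides_meet:
  assumes V: "finite V" "V \<subseteq> int_lattice" "Q = convex hull V"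
    and lat: "a \<in> int_lattice" "b \<in> int_lattice" "c \<in> int_lattice"
    and m: "closed_segment a b \<inter> Q \<noteq> {}" "closed_segment b c \<inter> Q \<noteq> {}" "closed_segment c a \<inter> Q \<noteq> {}"
  shows "convex hull {a, b, c} \<inter> Q \<inter> int_lattice \<noteq> {}"
  using lat m
proof (induction "nat \<lfloor>\<bar>cross2 (b - a) (c - a)\<bar>\<rfloor>" arbitrary: a b c rule: less_induct)
  case less
  note lat = less.prems(1-3) and m = less.prems(4-6)
  have Q: "convex Q" "closed Q" using V by (auto simp: compact_imp_closed finite_imp_compact_convex_hull)
  show ?case
  proof (cases "a \<in> Q \<or> b \<in> Q \<or> c \<in> Q")
    case True
    then show ?thesis using lat hull_inc[of _ "{a, b, c}" convex] by auto
  next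
    case False
    then have no: "a \<notin> Q" "b \<notin> Q" "c \<notin> Q" by auto
    define D where "D = cross2 (b - a) (c - a)"
    have DZ: "D \<in> \<int>" unfolding D_def using lat by (intro cross2_int_lattice int_lattice_diff)
    \<comment> \<open>In a degenerate triangle one vertex lies between the other two. Both sides at
      it meet \<open>Q\<close>, which would put that vertex in \<open>Q\<close>.\<close>
    have "D \<noteq> 0"
      using cross2_eq_0_imp_between[of b a c] collinear_triple_meets[OF Q] m no
      unfolding D_def by (metis closed_segment_commute)
    moreover have "\<bar>D\<bar> \<noteq> 1"
      using unimodular_triangle_vertex_in_polygon[OF V(2,3) lat _ m] no by (auto simp: D_def)
    ultimately have D: "1 < \<bar>D\<bar>" using DZ by (auto elim!: Ints_cases)
    then obtain \<alpha> \<beta> \<gamma> where w: "0 \<le> \<alpha>" "0 \<le> \<beta>" "0 \<le> \<gamma>" "\<alpha> < 1" "\<beta> < 1" "\<gamma> < 1" "\<alpha> + \<beta> + \<gamma> = 1"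
      and w_lat: "\<alpha> *\<^sub>R a + \<beta> *\<^sub>R b + \<gamma> *\<^sub>R c \<in> int_lattice"
      using lattice_triangle_has_nonvertex[OF lat] unfolding D_def by blast
    define w where "w = \<alpha> *\<^sub>R a + \<beta> *\<^sub>R b + \<gamma> *\<^sub>R c"
    have w_hull: "w \<in> convex hull {a, b, c}" unfolding convex_hull_3 using w w_def by blast
    show ?thesis
    proof (cases "w \<in> Q")
      case True
      then show ?thesis using w_hull w_lat w_def by blast
    next
      case wQ: False
      then obtain n k where n: "n \<bullet> w < k" "\<And>z. z \<in> Q \<Longrightarrow> k < n \<bullet> z"
        using separating_hyperplane_closed_point[OF Q, of w] by blast
      define u where "u = (\<lambda>z. - (n \<bullet> z))"
      have u: "u z < u w" if "z \<in> Q" for z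
        using n(1) n(2)[OF that] by (simp add: u_def)
      have u_lin: "linear u" by (simp add: u_def linear_iff inner_right_distrib)
      have "\<exists>x\<in>{a, b, c}. u w \<le> u x"
      proof (rule ccontr)
        assume "\<not> ?thesis"
        then have "u w < u w"
          by - (rule linear_less_convex_hull[OF u_lin _ w_hull]; auto simp: not_le)
        then show False by simp
      qed
      moreover have smaller: "\<delta> * \<bar>D\<bar> < \<bar>D\<bar>" if "\<delta> < 1" for \<delta>
        using that D mult_strict_right_mono[of \<delta> 1 "\<bar>D\<bar>"] by linarith
      \<comment> \<open>The induction hypothesis for a triangle formed with \<open>w\<close>: its
        determinant is an integer smaller in absolute value, so the measure drops, and the triangle
        stays inside the old one.\<close>
      have desc: ?thesis
        if h: "cross2 (y - x) (z - x) = \<delta> * D" "0 \<le> \<delta>" "\<delta> < 1" "{x, y, z} \<subseteq> insert w {a, b, c}"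
          "closed_segment x y \<inter> Q \<noteq> {}" "closed_segment y z \<inter> Q \<noteq> {}" "closed_segment z x \<inter> Q \<noteq> {}"
        for x y z \<delta>
      proof -
        have lat': "x \<in> int_lattice" "y \<in> int_lattice" "z \<in> int_lattice"
          using h(4) lat w_lat w_def by auto
        have "cross2 (y - x) (z - x) \<in> \<int>" using lat' by (intro cross2_int_lattice int_lattice_diff)
        then have i: "\<bar>\<delta> * D\<bar> \<in> \<int>" "\<bar>D\<bar> \<in> \<int>" using h(1) DZ by auto
        have "\<bar>\<delta> * D\<bar> < \<bar>D\<bar>" using smaller[OF h(3)] h(2) by (simp add: abs_mult)
        then have "nat \<lfloor>\<bar>cross2 (y - x) (z - x)\<bar>\<rfloor> < nat \<lfloor>\<bar>D\<bar>\<rfloor>"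
          using i h(1) by (auto elim!: Ints_cases)
        then have "convex hull {x, y, z} \<inter> Q \<inter> int_lattice \<noteq> {}"
          using less.hyps[OF _ lat' h(5-7)] by (simp add: D_def)
        moreover have "convex hull {x, y, z} \<subseteq> convex hull {a, b, c}"
          using h(4) w_hull hull_inc[of _ "{a, b, c}" convex]
          by (intro hull_minimal) auto
        ultimately show ?thesis by blast
      qed
      obtain z\<^sub>a z\<^sub>b z\<^sub>c where z: "z\<^sub>a \<in> Q" "z\<^sub>a \<in> closed_segment b c" "z\<^sub>b \<in> Q" "z\<^sub>b \<in> closed_segment c a"
        "z\<^sub>c \<in> Q" "z\<^sub>c \<in> closed_segment a b" using m by blast
      ultimately consider "u w \<le> u a" | "u w \<le> u b" | "u w \<le> u c" by blast
      then show ?thesis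
      proof cases
        case 1
        have "closed_segment w b \<inter> Q \<noteq> {}" "closed_segment c w \<inter> Q \<noteq> {}"
          using corner_replacement[OF Q(1) z(5,6,3,4) u_lin u 1 w(1-3,7) w_def no(2,3)] by auto
        moreover have "cross2 (b - w) (c - w) = \<alpha> * D"
        proof -
          have \<alpha>: "\<alpha> = 1 - \<beta> - \<gamma>" using w by simp
          show ?thesis unfolding w_def D_def \<alpha> by (simp add: cross2_def algebra_simps)
        qed
        ultimately show ?thesis using desc[of b w c \<alpha>] w m by auto
      next
        case 2
        have w': "\<beta> + \<gamma> + \<alpha> = 1" "w = \<beta> *\<^sub>R b + \<gamma> *\<^sub>R c + \<alpha> *\<^sub>R a" using w w_def by auto
        have "closed_segment w c \<inter> Q \<noteq> {}" "closed_segment a w \<inter> Q \<noteq> {}"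
          using corner_replacement[OF Q(1) z(1,2,5,6) u_lin u 2 w(2,3,1) w' no(3,1)] by auto
        moreover have "cross2 (c - w) (a - w) = \<beta> * D"
        proof -
          have \<beta>: "\<beta> = 1 - \<alpha> - \<gamma>" using w by simp
          show ?thesis unfolding w_def D_def \<beta> by (simp add: cross2_def algebra_simps)
        qed
        ultimately show ?thesis using desc[of c w a \<beta>] w m by auto
      next
        case 3
        have w': "\<gamma> + \<alpha> + \<beta> = 1" "w = \<gamma> *\<^sub>R c + \<alpha> *\<^sub>R a + \<beta> *\<^sub>R b" using w w_def by auto
        have "closed_segment w a \<inter> Q \<noteq> {}" "closed_segment b w \<inter> Q \<noteq> {}"
          using corner_replacement[OF Q(1) z(3,4,1,2) u_lin u 3 w(3,1,2) w' no(1,2)] by auto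
        moreover have "cross2 (a - w) (b - w) = \<gamma> * D"
        proof -
          have \<gamma>: "\<gamma> = 1 - \<alpha> - \<beta>" using w by simp
          show ?thesis unfolding w_def D_def \<gamma> by (simp add: cross2_def algebra_simps)
        qed
        ultimately show ?thesis using desc[of a w b \<gamma>] w m by auto
      qed
    qed
  qed
qed

section \<open>Segments that cut \<open>Q\<close> and the edges they cross\<close>

text \<open>By Caratheodory a common point \<open>z\<close> lies in a triangle, possibly degenerate,
  with vertices in \<open>S\<close>. A segment inside \<open>Q\<close> from \<open>z\<close> to a
  point outside \<open>P\<close> must leave this triangle through a side.\<close>

lemma intersecting_hulls_separated_pair:
  fixes S :: "(real ^ 2) set"
  assumes S: "P = convex hull S" and Q: "convex Q" "\<not> Q \<subseteq> P" and ne: "P \<inter> Q \<noteq> {}"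
  obtains a b where "a \<in> S" "b \<in> S" "closed_segment a b \<inter> Q \<noteq> {}"
proof -
  obtain z where z: "z \<in> P" "z \<in> Q" using ne by blast
  obtain v where v: "v \<in> Q" "v \<notin> P" using Q by blast
  obtain T where T: "finite T" "T \<subseteq> S" "card T \<le> 3" "z \<in> convex hull T"
    using z(1) unfolding S by (subst (asm) caratheodory) auto
  have "\<exists>a b c. T = {a, b, c}"
  proof -
    have "T \<noteq> {}" using T by auto
    then consider "card T = 1" | "card T = 2" | "card T = 3"
      using T(1,3) by (metis One_nat_def Suc_1 card_eq_0_iff le_SucE le_zero_eq numeral_3_eq_3)
    then show ?thesis
    proof cases
      case 1
      then show ?thesis by (metis card_1_singletonE insert_absorb2)
    next
      case 2
      then show ?thesis by (metis card_2_iff insert_absorb2)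
    next
      case 3
      then show ?thesis by (metis card_3_iff)
    qed
  qed
  then obtain a b c where abc: "T = {a, b, c}" by blast
  have "convex hull T \<subseteq> P" unfolding S using T by (simp add: hull_mono)
  then have "closed_segment z v \<inter> frontier (convex hull {a, b, c}) \<noteq> {}"
    using v T abc by (intro connected_Int_frontier) auto
  moreover have "closed_segment z v \<subseteq> Q" using z v Q by (simp add: closed_segment_subset)
  ultimately have "Q \<inter> (closed_segment a b \<union> closed_segment b c \<union> closed_segment c a) \<noteq> {}"
    by (auto simp: frontier_of_triangle)
  then show ?thesis using that T(2) abc by blast
qed

text \<open>Finds the edge of \<open>Q\<close> facing \<open>a\<close>. Among the finitely many
  pairs of vertices of \<open>Q\<close> on opposite sides of the line \<open>a b\<close>, the pair
  whose segment crosses that line nearest to \<open>a\<close> spans a supporting line of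
  \<open>Q\<close>.\<close>

lemma crossing_edge:
  assumes V: "finite V" "Q = convex hull V"
    and ab: "a \<notin> Q" "b \<notin> Q" "closed_segment a b \<inter> Q \<noteq> {}"
    and VP: "closed_segment a b \<inter> V = {}"
  obtains f f' where "f \<in> V" "f' \<in> V" "closed_segment f f' \<inter> closed_segment a b \<noteq> {}"
    "\<And>z. z \<in> Q \<Longrightarrow> cross2 (f - f') z \<le> cross2 (f - f') f" "cross2 (f - f') f < cross2 (f - f') a"
proof -
  have Q: "convex Q" by (simp add: V)
  have VQ: "v \<in> Q" if "v \<in> V" for v using that V by (simp add: hull_inc)
  have "a \<noteq> b" using ab by auto
  obtain g where g: "g \<in> Q" "g \<in> closed_segment a b" using ab by blast
  define h where "h = (\<lambda>z. cross2 (b - a) (z - a))"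
  have on_line: "\<exists>k. z = a + k *\<^sub>R (b - a)" if "h z = 0" for z
    using cross2_eq_0_imp_scaleR[of "b - a" "z - a"] that \<open>a \<noteq> b\<close>
    by (metis add_diff_cancel_left' diff_add_cancel eq_iff_diff_eq_0 h_def add.commute)
  have in_seg: "\<exists>k. z = a + k *\<^sub>R (b - a) \<and> 0 < k \<and> k < 1" if "z \<in> Q" "h z = 0" for z
    using on_line[OF that(2)] convex_line_in_open_segment[OF Q ab(1,2) g] that(1) by blast
  have to_seg: "a + k *\<^sub>R (b - a) \<in> closed_segment a b" if "0 < k" "k < 1" for k
    unfolding in_segment using that by (intro exI[of _ k]) (auto simp: algebra_simps)
  \<comment> \<open>A vertex of \<open>Q\<close> on the line would lie in the open segment
    \<open>a b\<close>, which \<open>VP\<close> excludes. So the line splits the vertices into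
    \<open>Vp\<close> and \<open>Vm\<close>.\<close>
  have hV: "h v \<noteq> 0" if "v \<in> V" for v
    using in_seg[OF VQ[OF that]] to_seg VP that by blast
  have hg: "cross2 (b - a) g = cross2 (b - a) a"
  proof -
    obtain l where l: "g = (1 - l) *\<^sub>R a + l *\<^sub>R b" using g(2) by (auto simp: in_segment)
    show ?thesis unfolding l by (simp add: cross2_def algebra_simps)
  qed
  define Vp Vm where "Vp = {v \<in> V. 0 < h v}" and "Vm = {v \<in> V. h v < 0}"
  have h_eq: "h z = cross2 (b - a) z - cross2 (b - a) a" for z
    by (simp add: h_def cross2_diff_right)
  have "Vp \<noteq> {}"
  proof
    assume "Vp = {}"
    then have "cross2 (b - a) v < cross2 (b - a) a" if "v \<in> V" for v
      using hV[OF that] that h_eq[of v] unfolding Vp_def by force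
    then have "cross2 (b - a) g < cross2 (b - a) a"
      using g(1) V by - (rule linear_less_convex_hull[OF linear_cross2, of V]; auto)
    with hg show False by simp
  qed
  moreover have "Vm \<noteq> {}"
  proof
    assume "Vm = {}"
    then have "cross2 (b - a) a < cross2 (b - a) v" if "v \<in> V" for v
      using hV[OF that] that h_eq[of v] unfolding Vm_def by force
    then have "cross2 (b - a) a < cross2 (b - a) g"
      using g(1) V by - (rule linear_greater_convex_hull[OF linear_cross2, of V]; auto)
    with hg show False by simp
  qed
  ultimately have ne: "Vp \<times> Vm \<noteq> {}" by auto
  have fin: "finite (Vp \<times> Vm)" using V by (simp add: Vp_def Vm_def)
  \<comment> \<open>position, measured from \<open>a\<close> along the line \<open>a b\<close>, of its crossing with the segment \<open>f f'\<close>\<close>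
  define K where "K = (\<lambda>(f, f'). cross2 (f' - a) (f - a) / (h f - h f'))"
  obtain p where p: "p \<in> Vp \<times> Vm" "\<And>p'. p' \<in> Vp \<times> Vm \<Longrightarrow> K p \<le> K p'"
    using arg_min_if_finite(1)[OF fin ne] arg_min_least[OF fin ne] by blast
  obtain f f' where pf: "p = (f, f')" by (cases p)
  have f: "f \<in> V" "0 < h f" "f' \<in> V" "h f' < 0" using p(1) pf by (auto simp: Vp_def Vm_def)
  have H: "0 < h f - h f'" using f by simp
  define c where "c = (1 - h f / (h f - h f')) *\<^sub>R f + (h f / (h f - h f')) *\<^sub>R f'"
  have r01: "0 \<le> h f / (h f - h f')" "h f / (h f - h f') \<le> 1" using f by (auto simp: divide_simps)
  have c_seg: "c \<in> closed_segment f f'" unfolding in_segment c_def using r01 by blast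
  have cQ: "c \<in> Q" using c_seg closed_segment_subset[OF VQ VQ Q] f by blast
  have h_comb: "h ((1 - l) *\<^sub>R x + l *\<^sub>R y) = (1 - l) * h x + l * h y" for l x y
    by (simp add: h_def cross2_def algebra_simps)
  have "h c = h f - (h f / (h f - h f')) * (h f - h f')"
    unfolding c_def h_comb by (simp only: algebra_simps)
  also have "\<dots> = 0" using H by simp
  finally obtain k where k: "c = a + k *\<^sub>R (b - a)" "0 < k" "k < 1" using in_seg[OF cQ] by blast
  have "cross2 (f - f') ((1 - l) *\<^sub>R f + l *\<^sub>R f') = cross2 (f - f') f" for l
    by (simp add: cross2_def algebra_simps)
  then have "cross2 (f - f') c = cross2 (f - f') f" unfolding c_def .
  moreover have "cross2 (f - f') c = cross2 (f - f') a - k * (h f - h f')"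
    unfolding k(1) h_def by (simp add: cross2_def algebra_simps)
  moreover have "0 < k * (h f - h f')" using k(2) H by simp
  ultimately have a_beyond: "cross2 (f - f') f < cross2 (f - f') a" by linarith
  \<comment> \<open>A vertex strictly beyond the line \<open>f f'\<close> could replace whichever of
    \<open>f\<close>, \<open>f'\<close> is on its side of \<open>a b\<close>. The new pair would
    cross nearer to \<open>a\<close>, against the choice of \<open>p\<close>.\<close>
  have "cross2 (f - f') v \<le> cross2 (f - f') f" if v: "v \<in> V" for v
  proof (rule ccontr)
    assume "\<not> ?thesis"
    then have pos: "0 < cross2 (f - f') (v - f)" by (simp add: cross2_diff_right)
    show False
    proof (cases "0 < h v")
      case True
      then have "K (f, f') \<le> K (v, f')" using p pf f v by (auto simp: Vp_def Vm_def)
      moreover have Hv: "0 < h v - h f'" using True f by simp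
      ultimately have "cross2 (f' - a) (f - a) * (h v - h f') \<le> cross2 (f' - a) (v - a) * (h f - h f')"
        using H by (simp add: K_def field_simps)
      moreover have "cross2 (f' - a) (f - a) * (h v - h f') - cross2 (f' - a) (v - a) * (h f - h f')
          = - h f' * cross2 (f - f') (v - f)"
        by (simp add: h_def cross2_def algebra_simps)
      moreover have "0 < - h f' * cross2 (f - f') (v - f)" using pos f by (simp add: mult_neg_pos)
      ultimately show False by linarith
    next
      case False
      then have hv: "h v < 0" using hV[OF v] by simp
      then have "K (f, f') \<le> K (f, v)" using p pf f v by (auto simp: Vp_def Vm_def)
      moreover have Hv: "0 < h f - h v" using hv f by simp
      ultimately have "cross2 (f' - a) (f - a) * (h f - h v) \<le> cross2 (v - a) (f - a) * (h f - h f')"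
        using H by (simp add: K_def field_simps)
      moreover have "cross2 (f' - a) (f - a) * (h f - h v) - cross2 (v - a) (f - a) * (h f - h f')
          = h f * cross2 (f - f') (v - f)"
        by (simp add: h_def cross2_def algebra_simps)
      moreover have "0 < h f * cross2 (f - f') (v - f)" using pos f by simp
      ultimately show False by linarith
    qed
  qed
  then have "cross2 (f - f') z \<le> cross2 (f - f') f" if "z \<in> Q" for z
    using that V by - (rule linear_le_convex_hull[OF linear_cross2, of V]; auto)
  then show ?thesis using that[OF f(1,3) _ _ a_beyond] c_seg k to_seg by blast
qed

section \<open>What the fan condition says about opposite edges\<close>

text \<open>If \<open>q\<close> had a single minimiser \<open>x\<close> in \<open>S\<close>, the
  normal cone of \<open>{x}\<close> would contain \<open>- q\<close> tilted slightly either way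
  along \<open>f' - f\<close>. The fan condition then yields one point \<open>w\<close> maximising
  both tilts of \<open>q\<close> over \<open>Q\<close>, which forces the tilt \<open>r\<close> to
  agree on \<open>f\<close> and \<open>f'\<close>.\<close>

lemma opposite_edge_of_coarsening:
  fixes q :: "real ^ 2 \<Rightarrow> real"
  assumes S: "finite S" "P = convex hull S" "P \<noteq> {}"
    and Q: "f \<in> Q" "f' \<in> Q" "f \<noteq> f'" and q: "linear q" "q f' = q f" "\<And>z. z \<in> Q \<Longrightarrow> q z \<le> q f"
    and fan: "coarsens (normal_fan (uminus ` Q)) (normal_fan P)"
  obtains x x' where "x \<in> S" "x' \<in> S" "x \<noteq> x'" "q x' = q x" "\<And>z. z \<in> P \<Longrightarrow> q x \<le> q z"
proof -
  have Sne: "S \<noteq> {}" using S by auto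
  define m where "m = Min (q ` S)"
  obtain n where n: "q = (\<lambda>z. n \<bullet> z)"
  proof
    show "q = (\<lambda>z. adjoint q 1 \<bullet> z)"
      using adjoint_works[OF q(1), of _ 1] by (auto simp: inner_commute)
  qed
  have mS: "m \<le> q s" if "s \<in> S" for s using that S by (simp add: m_def)
  have mP: "m \<le> q z" if "z \<in> P" for z
    using that mS S(2) by - (rule linear_ge_convex_hull[OF q(1), of S]; auto)
  have "m \<in> q ` S" using S Sne by (simp add: m_def)
  then obtain x where x: "x \<in> S" "q x = m" by auto
  show ?thesis
  proof (cases "\<exists>x'\<in>S. x' \<noteq> x \<and> q x' = m")
    case True
    then show ?thesis using that x mP by metis
  next
    case False
    define G where "G = P \<inter> {z. n \<bullet> z = m}"
    have G: "G face_of P" unfolding G_def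
      using mP S n by (intro face_of_Int_supporting_hyperplane_ge) auto
    then obtain S' where S': "S' \<subseteq> S" "G = convex hull S'"
      using face_of_convex_hull_subset[of S G] S finite_imp_compact by blast
    have "s = x" if "s \<in> S'" for s
      using that S' False hull_inc[of s S' convex] n unfolding G_def by blast
    moreover have xG: "x \<in> G" using x n S by (auto simp: G_def hull_inc)
    then have "S' \<noteq> {}" using S' by auto
    ultimately have "S' = {x}" by blast
    then have Gx: "G = {x}" using S' by simp
    then have "normal_cone P {x} \<in> normal_fan P" using G unfolding normal_fan_def by auto
    then obtain G' where G': "G' face_of (uminus ` Q)" "G' \<noteq> {}" "normal_cone P {x} \<subseteq> normal_cone (uminus ` Q) G'"
      using fan unfolding coarsens_def normal_fan_def by blast
    then obtain w where w: "w \<in> Q" "- w \<in> G'" using face_of_imp_subset by blast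
    define r where "r = (\<lambda>z. (f' - f) \<bullet> z)"
    have r: "linear r" by (simp add: r_def linear_iff inner_right_distrib)
    have rf: "r f \<noteq> r f'"
      using Q(3) by (metis eq_iff_diff_eq_0 inner_diff_right inner_eq_zero_iff r_def)
    \<comment> \<open>A tilt small enough to keep \<open>x\<close> minimal over the finite set
      \<open>S\<close>; the induction takes a minimum of one bound per point.\<close>
    have "\<exists>\<epsilon>>0. \<forall>s\<in>S. \<epsilon> * \<bar>r s - r x\<bar> \<le> q s - q x"
    proof -
      have "\<exists>\<epsilon>>0. \<forall>s\<in>T. \<epsilon> * \<bar>r s - r x\<bar> \<le> q s - q x" if "finite T" "T \<subseteq> S" for T
        using that
      proof (induction T rule: finite_induct)
        case empty
        then show ?case by (auto intro: exI[of _ 1])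
      next
        case (insert t T)
        then obtain \<epsilon> where \<epsilon>: "\<epsilon> > 0" "\<forall>s\<in>T. \<epsilon> * \<bar>r s - r x\<bar> \<le> q s - q x" by auto
        show ?case
        proof (cases "t = x")
          case True
          then show ?thesis using \<epsilon> by auto
        next
          case False
          have "q t \<noteq> m" using \<open>\<not> (\<exists>x'\<in>S. x' \<noteq> x \<and> q x' = m)\<close> False insert.prems by blast
          then have pos: "0 < q t - q x" using mS[of t] insert.prems x(2) by simp
          \<comment> \<open>The summand 1 keeps the denominator positive when
            \<open>r t = r x\<close>.\<close>
          define \<eta> where "\<eta> = (q t - q x) / (1 + \<bar>r t - r x\<bar>)"
          have d: "0 < 1 + \<bar>r t - r x\<bar>" by simp
          have \<eta>: "0 < \<eta>" using pos d by (simp add: \<eta>_def)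
          have "\<eta> * (1 + \<bar>r t - r x\<bar>) = q t - q x" using d by (simp add: \<eta>_def)
          then have \<eta>t: "\<eta> * \<bar>r t - r x\<bar> \<le> q t - q x" using \<eta> by (simp add: algebra_simps)
          have "min \<epsilon> \<eta> * \<bar>r s - r x\<bar> \<le> q s - q x" if "s \<in> insert t T" for s
          proof (cases "s = t")
            case True
            have "min \<epsilon> \<eta> * \<bar>r t - r x\<bar> \<le> \<eta> * \<bar>r t - r x\<bar>" by (intro mult_right_mono) auto
            then show ?thesis using True \<eta>t by simp
          next
            case False
            have "min \<epsilon> \<eta> * \<bar>r s - r x\<bar> \<le> \<epsilon> * \<bar>r s - r x\<bar>" by (intro mult_right_mono) auto
            then show ?thesis using False that \<epsilon> by fastforce
          qed
          then show ?thesis using \<epsilon> \<eta> by (intro exI[of _ "min \<epsilon> \<eta>"]) auto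
        qed
      qed
      then show ?thesis using S by blast
    qed
    then obtain \<epsilon> where \<epsilon>: "\<epsilon> > 0" "\<And>s. s \<in> S \<Longrightarrow> \<epsilon> * \<bar>r s - r x\<bar> \<le> q s - q x" by blast
    have key: "q z + k * r z \<le> q w + k * r w" if k: "\<bar>k\<bar> = \<epsilon>" and z: "z \<in> Q" for k z
    proof -
      define u where "u = (\<lambda>z. - (q z + k * r z))"
      have u: "linear u"
        by (rule linearI) (simp_all add: u_def linear_add[OF q(1)] linear_add[OF r]
            linear_cmul[OF q(1)] linear_cmul[OF r] algebra_simps)
      have "u y \<le> u x" if y: "y \<in> P" for y
      proof -
        have "u s \<le> u x" if "s \<in> S" for s
        proof -
          have "k * (r x - r s) \<le> \<bar>k * (r x - r s)\<bar>" by simp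
          also have "\<dots> = \<epsilon> * \<bar>r s - r x\<bar>" by (simp add: abs_mult k abs_minus_commute)
          also have "\<dots> \<le> q s - q x" using \<epsilon>(2)[OF that] .
          finally show ?thesis by (simp add: u_def algebra_simps)
        qed
        then show ?thesis using y S(2) by - (rule linear_le_convex_hull[OF u, of S]; auto)
      qed
      then have "u \<in> normal_cone P {x}" using u xG Gx by (auto simp: normal_cone_def G_def)
      then have "u \<in> normal_cone (uminus ` Q) G'" using G' by blast
      then have "u (- z) \<le> u (- w)" using w z by (auto simp: normal_cone_def)
      then show ?thesis using linear_neg[OF q(1)] linear_neg[OF r] by (simp add: u_def)
    qed
    have e: "\<bar>\<epsilon>\<bar> = \<epsilon>" "\<bar>- \<epsilon>\<bar> = \<epsilon>" using \<epsilon>(1) by auto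
    \<comment> \<open>As \<open>q w\<close> is at most the common value of \<open>q\<close> at
      \<open>f\<close> and \<open>f'\<close>, the two tilts give opposite inequalities between
      \<open>r w\<close> and \<open>r f\<close>, and likewise for \<open>f'\<close>.\<close>
    have "q w \<le> q f" using q(3) w by blast
    then have "\<epsilon> * r f = \<epsilon> * r w" "\<epsilon> * r f' = \<epsilon> * r w"
      using key[OF e(1) Q(1)] key[OF e(2) Q(1)] key[OF e(1) Q(2)] key[OF e(2) Q(2)] q(2) by linarith+
    then show ?thesis using \<epsilon>(1) rf by simp
  qed
qed

section \<open>Chords parallel to an edge\<close>

text \<open>Measured by \<open>cross2 (y - x)\<close>, the gap between the lines \<open>x y\<close>
  and \<open>x' y'\<close> is \<open>A\<close> at \<open>x'\<close> and \<open>B\<close> at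
  \<open>y'\<close>, and affine in between. Equal signs and \<open>A\<close> no larger in size mean
  that it does not shrink on the way to \<open>y'\<close>. The chord is parallel to
  \<open>x' - x\<close>, so the ratio of gaps is the ratio of lengths.\<close>

lemma long_chord_of_converging_sides:
  assumes P: "convex P" "x \<in> P" "x' \<in> P" "y \<in> P" "y' \<in> P"
    and d: "d \<noteq> 0" "cross2 d x' = cross2 d x" "cross2 d x < \<beta>" "\<beta> < cross2 d y" "\<beta> < cross2 d y'"
    and AB: "0 < cross2 (y - x) (x' - x) * cross2 (y - x) (y' - y)"
      "\<bar>cross2 (y - x) (x' - x)\<bar> \<le> \<bar>cross2 (y - x) (y' - y)\<bar>"
  shows "\<exists>g \<kappa>. 1 \<le> \<kappa> \<and> g \<in> P \<and> g + \<kappa> *\<^sub>R (x' - x) \<in> P \<and> cross2 d g = \<beta>"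
proof -
  obtain t where t: "0 \<le> t" "t \<le> 1" "(1 - t) * cross2 d x + t * cross2 d y = \<beta>"
    using crossing_coefficient[of "cross2 d x" \<beta> "cross2 d y"] d by auto
  obtain t' where t': "0 \<le> t'" "t' \<le> 1" "(1 - t') * cross2 d x' + t' * cross2 d y' = \<beta>"
    using crossing_coefficient[of "cross2 d x'" \<beta> "cross2 d y'"] d by auto
  define g g' where "g = (1 - t) *\<^sub>R x + t *\<^sub>R y" and "g' = (1 - t') *\<^sub>R x' + t' *\<^sub>R y'"
  have gP: "g \<in> P" "g' \<in> P"
    unfolding g_def g'_def using P t t' by (auto intro: convexD_alt)
  have qg: "cross2 d g = \<beta>" "cross2 d g' = \<beta>"
    unfolding g_def g'_def using t t' by (simp_all add: cross2_add_right cross2_scaleR_right)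
  define A B where "A = cross2 (y - x) (x' - x)" and "B = cross2 (y - x) (y' - y)"
  obtain k where k: "x' - x = k *\<^sub>R d"
    using cross2_eq_0_imp_scaleR[of d "x' - x"] d by (auto simp: cross2_diff_right)
  obtain k' where k': "g' - g = k' *\<^sub>R d"
    using cross2_eq_0_imp_scaleR[of d "g' - g"] d qg by (auto simp: cross2_diff_right)
  have "A \<noteq> 0" using AB(1) by (auto simp: A_def)
  then have "k \<noteq> 0" unfolding A_def k by (auto simp: cross2_def)
  define \<kappa> where "\<kappa> = k' / k"
  have g': "g' = g + \<kappa> *\<^sub>R (x' - x)"
    using k k' \<open>k \<noteq> 0\<close> by (simp add: \<kappa>_def algebra_simps)
  have "cross2 (y - x) (g' - g) = A + t' * (B - A)"
    by (simp add: g_def g'_def A_def B_def cross2_def algebra_simps)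
  then have "(\<kappa> - 1) * A = t' * (B - A)"
    unfolding g' by (simp add: cross2_scaleR_right left_diff_distrib flip: A_def)
  then have "(\<kappa> - 1) * (A * A) = t' * (A * B - A * A)"
    by (metis (no_types, opaque_lifting) mult.assoc mult.left_commute right_diff_distrib)
  moreover have "A * A \<le> A * B"
  proof -
    have "A * A = \<bar>A\<bar> * \<bar>A\<bar>" by simp
    also have "\<dots> \<le> \<bar>A\<bar> * \<bar>B\<bar>" using AB(2) by (intro mult_left_mono) (auto simp: A_def B_def)
    also have "\<dots> = A * B" using AB(1) by (simp add: A_def B_def flip: abs_mult)
    finally show ?thesis .
  qed
  ultimately have "0 \<le> (\<kappa> - 1) * (A * A)" using t' by simp
  moreover have "0 < A * A" using \<open>A \<noteq> 0\<close> by (metis not_real_square_gt_zero)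
  ultimately have "1 \<le> \<kappa>" by (simp add: zero_le_mult_iff)
  then show ?thesis using gP qg g' by blast
qed

text \<open>The lines \<open>x y\<close> and \<open>x' y'\<close> cannot converge strictly in both directions.\<close>

lemma long_chord_in_one_direction:
  assumes P: "convex P" "x \<in> P" "x' \<in> P" "y \<in> P" "y' \<in> P" and ne: "x \<noteq> x'" "y \<noteq> y'"
    and d: "d \<noteq> 0" "cross2 d x' = cross2 d x" "cross2 d x < \<beta>" "\<beta> < cross2 d y" "\<beta> < cross2 d y'"
    and e: "e \<noteq> 0" "cross2 e y' = cross2 e y" "cross2 e y < \<gamma>" "\<gamma> < cross2 e x" "\<gamma> < cross2 e x'"
  shows "(\<exists>g \<kappa>. 1 \<le> \<kappa> \<and> g \<in> P \<and> g + \<kappa> *\<^sub>R (x' - x) \<in> P \<and> cross2 d g = \<beta>) \<or>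
    (\<exists>g \<kappa>. 1 \<le> \<kappa> \<and> g \<in> P \<and> g + \<kappa> *\<^sub>R (y' - y) \<in> P \<and> cross2 e g = \<gamma>)"
proof -
  obtain k where k: "x' - x = k *\<^sub>R d"
    using cross2_eq_0_imp_scaleR[of d "x' - x"] d by (auto simp: cross2_diff_right)
  obtain l where l: "y' - y = l *\<^sub>R e"
    using cross2_eq_0_imp_scaleR[of e "y' - y"] e by (auto simp: cross2_diff_right)
  have kl: "k \<noteq> 0" "l \<noteq> 0" using k l ne by auto
  \<comment> \<open>The condition \<open>k * m < 0\<close> orients the second edge so that
    \<open>x v\<close> and \<open>x' v'\<close> do not cross between the edges, that is,
    \<open>A\<close> and \<open>B\<close> have equal signs. Comparing their sizes decides which edge
    gets the long chord.\<close>
  have main: "(\<exists>g \<kappa>. 1 \<le> \<kappa> \<and> g \<in> P \<and> g + \<kappa> *\<^sub>R (x' - x) \<in> P \<and> cross2 d g = \<beta>) \<or>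
      (\<exists>g \<kappa>. 1 \<le> \<kappa> \<and> g \<in> P \<and> g + \<kappa> *\<^sub>R (v' - v) \<in> P \<and> cross2 e g = \<gamma>)"
    if v: "v \<in> P" "v' \<in> P" "\<beta> < cross2 d v" "\<beta> < cross2 d v'" "cross2 e v < \<gamma>" "v' - v = m *\<^sub>R e" "k * m < 0"
    for v v' m
  proof -
    define A B where "A = cross2 (v - x) (x' - x)" and "B = cross2 (v - x) (v' - v)"
    have A: "A = - k * (cross2 d v - cross2 d x)"
      unfolding A_def k by (simp add: cross2_def algebra_simps)
    have B: "B = m * (cross2 e x - cross2 e v)"
      unfolding B_def v(6) by (simp add: cross2_def algebra_simps)
    have "A * B = - (k * m) * ((cross2 d v - cross2 d x) * (cross2 e x - cross2 e v))"
      unfolding A B by (simp add: algebra_simps)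
    then have AB: "0 < A * B"
      using v d e by (simp add: mult_neg_pos)
    have ev: "cross2 e v' = cross2 e v"
    proof -
      have "v' = v + m *\<^sub>R e" using v(6) by (simp add: algebra_simps)
      then show ?thesis by (simp add: cross2_add_right cross2_scaleR_right cross2_self)
    qed
    have sw: "cross2 (x - v) z = - cross2 (v - x) z" for z by (simp add: cross2_def algebra_simps)
    show ?thesis
    proof (cases "\<bar>A\<bar> \<le> \<bar>B\<bar>")
      case True
      then show ?thesis
        using long_chord_of_converging_sides[OF P(1-3) v(1,2) d(1-3) v(3,4)] AB
        unfolding A_def B_def by blast
    next
      case False
      then have "\<bar>cross2 (x - v) (v' - v)\<bar> \<le> \<bar>cross2 (x - v) (x' - x)\<bar>"
        "0 < cross2 (x - v) (v' - v) * cross2 (x - v) (x' - x)"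
        using AB unfolding A_def B_def sw by (auto simp: mult.commute)
      then show ?thesis
        using long_chord_of_converging_sides[OF P(1) v(1,2) P(2,3) e(1) ev v(5) e(4,5)] by blast
    qed
  qed
  show ?thesis
  proof (cases "k * l < 0")
    case True
    then show ?thesis using main[of y y' l] P d e l by blast
  next
    case False
    then have "k * - l < 0" using kl by (simp add: not_less less_le)
    moreover have "y - y' = - l *\<^sub>R e" using l by (simp add: algebra_simps)
    ultimately consider "\<exists>g \<kappa>. 1 \<le> \<kappa> \<and> g \<in> P \<and> g + \<kappa> *\<^sub>R (x' - x) \<in> P \<and> cross2 d g = \<beta>"
      | g \<kappa> where "1 \<le> \<kappa>" "g \<in> P" "g + \<kappa> *\<^sub>R (y - y') \<in> P" "cross2 e g = \<gamma>"
      using main[of y' y "- l"] P d e by auto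
    then show ?thesis
    proof cases
      case 1
      then show ?thesis by blast
    next
      case 2
      \<comment> \<open>The labels \<open>y\<close>, \<open>y'\<close> were exchanged, so the chord
        is read from its other end.\<close>
      let ?g = "g + \<kappa> *\<^sub>R (y - y')"
      have "?g + \<kappa> *\<^sub>R (y' - y) = g" by (simp add: algebra_simps)
      moreover have "cross2 e ?g = \<gamma>"
        using 2 e by (simp add: cross2_add_right cross2_scaleR_right cross2_diff_right)
      ultimately show ?thesis using 2 by metis
    qed
  qed
qed

text \<open>The translates of \<open>f\<close> by integer multiples of \<open>e\<close> are spaced
  by \<open>e\<close> along the line, so a chord at least as long as \<open>e\<close> contains
  one.\<close>

lemma lattice_point_on_long_chord:
  assumes "f \<in> int_lattice" "e \<in> int_lattice" "e \<noteq> 0" and d: "d \<noteq> 0" "cross2 d e = 0" "cross2 d g = cross2 d f"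
    and \<kappa>: "1 \<le> \<kappa>" and P: "convex P" "g \<in> P" "g + \<kappa> *\<^sub>R e \<in> P"
  obtains p where "p \<in> int_lattice" "p \<in> P" "cross2 d p = cross2 d f"
proof -
  obtain k where k: "e = k *\<^sub>R d" using cross2_eq_0_imp_scaleR[OF d(2,1)] by blast
  obtain l where l: "f - g = l *\<^sub>R d"
    using cross2_eq_0_imp_scaleR[of d "f - g"] d by (auto simp: cross2_diff_right)
  have "k \<noteq> 0" using k assms(3) by auto
  define \<mu> where "\<mu> = l / k"
  have f: "f = g + \<mu> *\<^sub>R e" using l k \<open>k \<noteq> 0\<close> by (simp add: \<mu>_def algebra_simps)
  \<comment> \<open>The first such translate at or after \<open>g\<close> in the direction of
    \<open>e\<close>.\<close>
  define p where "p = f + of_int \<lceil>- \<mu>\<rceil> *\<^sub>R e"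
  define \<nu> where "\<nu> = (\<mu> + of_int \<lceil>- \<mu>\<rceil>) / \<kappa>"
  have "0 \<le> \<mu> + of_int \<lceil>- \<mu>\<rceil>" "\<mu> + of_int \<lceil>- \<mu>\<rceil> \<le> 1" by linarith+
  then have \<nu>: "0 \<le> \<nu>" "\<nu> \<le> 1" using \<kappa> by (auto simp: \<nu>_def)
  have "\<nu> * \<kappa> = \<mu> + of_int \<lceil>- \<mu>\<rceil>" using \<kappa> by (simp add: \<nu>_def)
  then have "p = g + (\<nu> * \<kappa>) *\<^sub>R e" unfolding p_def f by (simp add: algebra_simps)
  also have "\<dots> = (1 - \<nu>) *\<^sub>R g + \<nu> *\<^sub>R (g + \<kappa> *\<^sub>R e)" by (simp add: algebra_simps)
  also have "\<dots> \<in> P" using P \<nu> by (intro convexD_alt) auto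
  finally have "p \<in> P" .
  moreover have "p \<in> int_lattice" unfolding p_def using assms by (intro int_lattice_add int_lattice_scaleR) auto
  moreover have "cross2 d p = cross2 d f" using d by (simp add: p_def cross2_add_right cross2_scaleR_right)
  ultimately show ?thesis using that by blast
qed

section \<open>The two crossed edges of \<open>Q\<close> and the contradiction\<close>

theorem theorem3p2:
  fixes P Q :: "(real ^ 2) set"
  assumes "lattice_polygon P"
    and "lattice_polygon Q"
    and "P \<inter> Q \<noteq> {}"
    and "coarsens (normal_fan (uminus ` Q)) (normal_fan P)"
  shows "P \<inter> Q \<inter> int_lattice \<noteq> {}"
proof
  assume none: "P \<inter> Q \<inter> int_lattice = {}"
  obtain S where S: "finite S" "S \<subseteq> int_lattice" "P = convex hull S"
    using assms(1) unfolding lattice_polygon_def by blast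
  obtain V where V: "finite V" "V \<subseteq> int_lattice" "Q = convex hull V"
    using assms(2) unfolding lattice_polygon_def by blast
  have P: "convex P" and Q: "convex Q" by (auto simp: S V)
  have SP: "s \<in> P" "s \<notin> Q" if "s \<in> S" for s
    using that S none hull_inc[of s S convex] by blast+
  have VQ: "v \<in> Q" "v \<notin> P" if "v \<in> V" for v
    using that V none hull_inc[of v V convex] by blast+
  have "V \<noteq> {}" using assms(3) V by auto
  then have "\<not> Q \<subseteq> P" using VQ by blast
  then obtain a b where ab: "a \<in> S" "b \<in> S" "closed_segment a b \<inter> Q \<noteq> {}"
    using intersecting_hulls_separated_pair[OF S(3) Q] assms(3) by blast
  \<comment> \<open>Stated for arbitrary ends so that it applies to \<open>a b\<close> and to
    \<open>b a\<close>. It packages the edge of \<open>Q\<close> facing the first end, the opposite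
    edge \<open>x x'\<close> of \<open>P\<close>, and the fact that \<open>Q\<close> cuts that end
    off from every point of \<open>P\<close> on or below the edge line.\<close>
  have half: "\<exists>d f x x'. d \<noteq> 0 \<and> f \<in> int_lattice \<and> (\<forall>z\<in>P. cross2 d z = cross2 d f \<longrightarrow> z \<in> Q) \<and>
      x \<in> S \<and> x' \<in> S \<and> x \<noteq> x' \<and> cross2 d x' = cross2 d x \<and> cross2 d x < cross2 d f \<and>
      (\<forall>p\<in>P. cross2 d p \<le> cross2 d f \<longrightarrow> closed_segment a p \<inter> Q \<noteq> {})"
    if ab: "a \<in> S" "b \<in> S" "closed_segment a b \<inter> Q \<noteq> {}" for a b
  proof -
    have abP: "closed_segment a b \<subseteq> P" using SP ab P by (simp add: closed_segment_subset)
    then have "closed_segment a b \<inter> V = {}" using VQ by blast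
    then obtain f f' where f: "f \<in> V" "f' \<in> V" "closed_segment f f' \<inter> closed_segment a b \<noteq> {}"
      "\<And>z. z \<in> Q \<Longrightarrow> cross2 (f - f') z \<le> cross2 (f - f') f" "cross2 (f - f') f < cross2 (f - f') a"
      using crossing_edge[OF V(1,3) SP(2)[OF ab(1)] SP(2)[OF ab(2)] ab(3)] by blast
    define d where "d = f - f'"
    have d0: "d \<noteq> 0" using f(5) by (auto simp: d_def cross2_def)
    then have ff: "f \<noteq> f'" by (auto simp: d_def)
    have df': "cross2 d f' = cross2 d f" by (simp add: d_def cross2_def algebra_simps)
    obtain x x' where x: "x \<in> S" "x' \<in> S" "x \<noteq> x'" "cross2 d x' = cross2 d x"
      "\<And>z. z \<in> P \<Longrightarrow> cross2 d x \<le> cross2 d z"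
      using opposite_edge_of_coarsening[OF S(1,3) _ VQ(1)[OF f(1)] VQ(1)[OF f(2)] ff linear_cross2 df' _ assms(4)]
        assms(3) f(4) unfolding d_def by blast
    \<comment> \<open>The vertices \<open>f\<close>, \<open>f'\<close> of \<open>Q\<close> are
      lattice points and hence outside \<open>P\<close>, while \<open>P\<close> meets the segment
      between them. So \<open>P\<close> meets the whole line only inside that segment.\<close>
    have line: "z \<in> Q" if z: "z \<in> P" "cross2 d z = cross2 d f" for z
    proof -
      obtain g where g: "g \<in> P" "g \<in> closed_segment f f'" using f(3) abP by blast
      obtain k where "z - f = k *\<^sub>R d"
        using cross2_eq_0_imp_scaleR[of d "z - f"] d0 z by (auto simp: cross2_diff_right)
      then have zk: "z = f + (- k) *\<^sub>R (f' - f)" by (simp add: d_def algebra_simps)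
      then have k: "0 < - k \<and> - k < 1"
        using convex_line_in_open_segment[OF P VQ(2)[OF f(1)] VQ(2)[OF f(2)] g, of "- k"] z(1) by blast
      have "(1 - (- k)) *\<^sub>R f + (- k) *\<^sub>R f' \<in> Q"
        using k VQ f Q by (intro convexD_alt) auto
      then show ?thesis unfolding zk by (simp add: algebra_simps)
    qed
    \<comment> \<open>Otherwise the whole segment \<open>a b\<close> would lie strictly beyond the
      edge and miss \<open>Q\<close>.\<close>
    have "cross2 d b \<le> cross2 d f"
    proof (rule ccontr)
      assume b: "\<not> ?thesis"
      obtain g where g: "g \<in> Q" "g \<in> convex hull {a, b}" using ab(3) by (auto simp: segment_convex_hull)
      have "cross2 d f < cross2 d g"
        by (rule linear_greater_convex_hull[OF linear_cross2 _ g(2)]) (use b f(5) d_def in auto)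
      then show False using f(4)[OF g(1)] by (simp add: d_def)
    qed
    then have "cross2 d x \<le> cross2 d f" using x(5)[OF SP(1)[OF ab(2)]] by simp
    moreover have "cross2 d x \<noteq> cross2 d f" using line[of x] SP[OF x(1)] by blast
    ultimately have xf: "cross2 d x < cross2 d f" by simp
    have sep: "closed_segment a p \<inter> Q \<noteq> {}" if p: "p \<in> P" "cross2 d p \<le> cross2 d f" for p
    proof -
      obtain l where l: "0 \<le> l" "l \<le> 1" "(1 - l) * cross2 d p + l * cross2 d a = cross2 d f"
        using crossing_coefficient[OF p(2), of "cross2 d a"] f(5) by (auto simp: d_def)
      define z where "z = (1 - l) *\<^sub>R p + l *\<^sub>R a"
      have z_seg: "z \<in> closed_segment p a" unfolding z_def in_segment using l by blast
      then have "z \<in> P" using closed_segment_subset[OF p(1) SP(1)[OF ab(1)] P] by blast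
      moreover have "cross2 d z = cross2 d f"
        using l by (simp add: z_def cross2_add_right cross2_scaleR_right)
      ultimately show ?thesis using line z_seg closed_segment_commute by blast
    qed
    show ?thesis
      using d0 f(1) V(2) line x xf sep by (intro exI[of _ d] exI[of _ f] exI[of _ x] exI[of _ x']) auto
  qed
  obtain d f x x' where 1: "d \<noteq> 0" "f \<in> int_lattice" "\<And>z. z \<in> P \<Longrightarrow> cross2 d z = cross2 d f \<Longrightarrow> z \<in> Q"
    "x \<in> S" "x' \<in> S" "x \<noteq> x'" "cross2 d x' = cross2 d x" "cross2 d x < cross2 d f"
    "\<And>p. p \<in> P \<Longrightarrow> cross2 d p \<le> cross2 d f \<Longrightarrow> closed_segment a p \<inter> Q \<noteq> {}"
    using half[OF ab] by blast
  have ba: "closed_segment b a \<inter> Q \<noteq> {}" using ab(3) by (simp add: closed_segment_commute)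
  obtain e h y y' where 2: "e \<noteq> 0" "h \<in> int_lattice" "\<And>z. z \<in> P \<Longrightarrow> cross2 e z = cross2 e h \<Longrightarrow> z \<in> Q"
    "y \<in> S" "y' \<in> S" "y \<noteq> y'" "cross2 e y' = cross2 e y" "cross2 e y < cross2 e h"
    "\<And>p. p \<in> P \<Longrightarrow> cross2 e p \<le> cross2 e h \<Longrightarrow> closed_segment b p \<inter> Q \<noteq> {}"
    using half[OF ab(2,1) ba] by blast
  \<comment> \<open>A point \<open>p\<close> beyond neither edge would be cut off from both
    \<open>a\<close> and \<open>b\<close>, so all sides of the triangle \<open>a b p\<close> would
    meet \<open>Q\<close>.\<close>
  have beyond: "cross2 d f < cross2 d p \<or> cross2 e h < cross2 e p" if "p \<in> S" for p
  proof (rule ccontr)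
    assume "\<not> ?thesis"
    then have "closed_segment p a \<inter> Q \<noteq> {}" "closed_segment b p \<inter> Q \<noteq> {}"
      using 1(9)[of p] 2(9)[of p] SP(1)[OF that] by (auto simp: closed_segment_commute not_less)
    then have "convex hull {a, b, p} \<inter> Q \<inter> int_lattice \<noteq> {}"
      using lattice_triangle_sides_meet[OF V, of a b p] S(2) ab that by blast
    moreover have "convex hull {a, b, p} \<subseteq> P"
      unfolding S(3) using ab that by (intro hull_mono) auto
    ultimately show False using none by blast
  qed
  have no_chord: False
    if c: "d \<noteq> 0" "f \<in> int_lattice" "\<And>z. z \<in> P \<Longrightarrow> cross2 d z = cross2 d f \<Longrightarrow> z \<in> Q"
      "x \<in> S" "x' \<in> S" "x \<noteq> x'" "cross2 d x' = cross2 d x"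
      "\<exists>g \<kappa>. 1 \<le> \<kappa> \<and> g \<in> P \<and> g + \<kappa> *\<^sub>R (x' - x) \<in> P \<and> cross2 d g = cross2 d f" for d f x x'
  proof -
    have "x' - x \<in> int_lattice" using c S by (auto intro: int_lattice_diff)
    moreover have "x' - x \<noteq> 0" "cross2 d (x' - x) = 0" using c by (auto simp: cross2_diff_right)
    ultimately obtain p where "p \<in> int_lattice" "p \<in> P" "cross2 d p = cross2 d f"
      using lattice_point_on_long_chord[OF c(2)] c(1,8) P by metis
    then show False using c(3) none by blast
  qed
  \<comment> \<open>Each opposite edge of \<open>P\<close> lies below its own edge line of
    \<open>Q\<close>, hence beyond the other one.\<close>
  have "cross2 e h < cross2 e x" "cross2 e h < cross2 e x'" "cross2 d f < cross2 d y" "cross2 d f < cross2 d y'"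
    using beyond 1 2 by (metis less_asym)+
  then show False
    using long_chord_in_one_direction[OF P SP(1)[OF 1(4)] SP(1)[OF 1(5)] SP(1)[OF 2(4)] SP(1)[OF 2(5)]
        1(6) 2(6) 1(1,7,8) _ _ 2(1,7,8)]
      no_chord[OF 1(1-7)] no_chord[OF 2(1-7)] by blast
qed

end
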